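(* Let $\alpha\in\mathbb{R}$ and let $f\in D_\alpha$ with $f(0)\neq 0$. For integers $k\ge 0$, let $\varphi_k$ be the orthogonal polynomials for the weighted space $D_{\alpha,f}$, and for integers $n\ge 0$ let $p_n$ be the optimal approximant of order $n$ to $1/f$ in $D_\alpha$. Then $$p_n(z)=\overline{f(0)}\sum_{k=0}^n\overline{\varphi_k(0)}\,\varphi_k(z).$$
   Context: $\mathbb{D}=\{z\in\mathbb{C}:|z|<1\}$. For $\alpha\in\mathbb{R}$, the Dirichlet-type space $D_\alpha$ consists of all analytic functions $f=\sum_{k\ge 0}a_kz^k$ on $\mathbb{D}$ with $\|f\|_\alpha^2=\sum_{k=0}^\infty (k+1)^\alpha|a_k|^2<\infty$; it is a Hilbert space with inner product $\langle f,g\rangle_\alpha=\sum_{k=0}^\infty (k+1)^\alpha a_k\overline{b_k}$ for $g=\sum_{k\ge0} b_kz^k$. Let $\mathcal{P}_n$ be the space of complex polynomials of degree at most $n$. The optimal approximant of order $n$ to $1/f$ (in $D_\alpha$) is the unique $p_n\in\mathcal{P}_n$ minimizing $\|pf-1\|_\alpha$ over all $p\in\mathcal{P}_n$. The weighted space $D_{\alpha,f}$ has inner product $\langle\varphi,\psi\rangle_{\alpha,f}=\langle\varphi f,\psi f\rangle_\alpha$, and its orthogonal polynomials $(\varphi_k)_{k\ge0}$ are the unique polynomials such that $\varphi_k$ has degree exactly $k$ and positive leading coefficient and $\langle\varphi_kf,\varphi_jf\rangle_\alpha=\delta_{k,j}$ for all $k,j\ge0$. *)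

theory Defs
  imports "HOL-Complex_Analysis.Complex_Analysis" "HOL-Computational_Algebra.Polynomial"
begin

text \<open>
  Functions on the open unit disc are represented by total functions on \<^typ>\<open>complex\<close>;
  values outside the disc play no role.
\<close>

abbreviation taylor_coeff :: "(complex \<Rightarrow> complex) \<Rightarrow> nat \<Rightarrow> complex" where
  "taylor_coeff f k \<equiv> fps_nth (fps_expansion f 0) k"

definition dirichlet_space :: "real \<Rightarrow> (complex \<Rightarrow> complex) set" where
  "dirichlet_space \<alpha> =
     {f. f holomorphic_on ball 0 1 \<and>
         summable (\<lambda>k. (real k + 1) powr \<alpha> * (cmod (taylor_coeff f k))\<^sup>2)}"

definition dirichlet_norm :: "real \<Rightarrow> (complex \<Rightarrow> complex) \<Rightarrow> real" where
  "dirichlet_norm \<alpha> f = sqrt (\<Sum>k. (real k + 1) powr \<alpha> * (cmod (taylor_coeff f k))\<^sup>2)"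

definition dirichlet_inner ::
    "real \<Rightarrow> (complex \<Rightarrow> complex) \<Rightarrow> (complex \<Rightarrow> complex) \<Rightarrow> complex" where
  "dirichlet_inner \<alpha> f g =
     (\<Sum>k. of_real ((real k + 1) powr \<alpha>) * taylor_coeff f k * cnj (taylor_coeff g k))"

definition weighted_inner ::
    "real \<Rightarrow> (complex \<Rightarrow> complex) \<Rightarrow> (complex \<Rightarrow> complex) \<Rightarrow> (complex \<Rightarrow> complex) \<Rightarrow> complex" where
  "weighted_inner \<alpha> f \<phi> \<psi> = dirichlet_inner \<alpha> (\<lambda>z. \<phi> z * f z) (\<lambda>z. \<psi> z * f z)"

definition optimal_approximant ::
    "real \<Rightarrow> (complex \<Rightarrow> complex) \<Rightarrow> nat \<Rightarrow> complex poly \<Rightarrow> bool" where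
  "optimal_approximant \<alpha> f n p \<longleftrightarrow>
     degree p \<le> n \<and>
     (\<forall>q. degree q \<le> n \<longrightarrow>
        dirichlet_norm \<alpha> (\<lambda>z. poly p z * f z - 1) \<le> dirichlet_norm \<alpha> (\<lambda>z. poly q z * f z - 1))"

definition orthogonal_polynomials ::
    "real \<Rightarrow> (complex \<Rightarrow> complex) \<Rightarrow> (nat \<Rightarrow> complex poly) \<Rightarrow> bool" where
  "orthogonal_polynomials \<alpha> f \<phi> \<longleftrightarrow>
     (\<forall>k. degree (\<phi> k) = k \<and> lead_coeff (\<phi> k) \<in> \<real> \<and> Re (lead_coeff (\<phi> k)) > 0) \<and>
     (\<forall>k j. weighted_inner \<alpha> f (poly (\<phi> k)) (poly (\<phi> j)) = (if k = j then 1 else 0))"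

end

theory Submission
  imports Defs
begin

text \<open>
  Let \<open>P\<close> be the claimed polynomial. Pairing with the constant \<open>1\<close> in \<open>D\<^sub>\<alpha>\<close> is evaluation at
  \<open>0\<close>, so \<open>P f - 1\<close> is orthogonal to \<open>r f\<close> for every polynomial \<open>r\<close> of degree at most \<open>n\<close>:
  for \<open>r = \<Sum>\<^sub>k d\<^sub>k \<phi>\<^sub>k\<close> both \<open>\<langle>r f, P f\<rangle>\<close> and \<open>\<langle>r f, 1\<rangle>\<close> equal \<open>f(0) r(0)\<close>. By Pythagoras
  \<open>\<parallel>(P + r) f - 1\<parallel>\<^sup>2 = \<parallel>P f - 1\<parallel>\<^sup>2 + \<Sum>\<^sub>k \<bar>d\<^sub>k\<bar>\<^sup>2\<close>, and a minimizer \<open>P + r\<close> must have \<open>r = 0\<close>.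
\<close>

section \<open>Taylor coefficients at 0 and their behaviour under linear operations and
  multiplication by z\<close>

lemma dirichlet_spaceD:
  assumes "f \<in> dirichlet_space \<alpha>"
  shows "f holomorphic_on ball 0 1"
    and "f has_fps_expansion fps_expansion f 0"
    and "summable (\<lambda>k. (real k + 1) powr \<alpha> * (cmod (taylor_coeff f k))\<^sup>2)"
proof -
  show hol: "f holomorphic_on ball 0 1"
    and "summable (\<lambda>k. (real k + 1) powr \<alpha> * (cmod (taylor_coeff f k))\<^sup>2)"
    using assms by (auto simp: dirichlet_space_def)
  show "f has_fps_expansion fps_expansion f 0"
    by (rule has_fps_expansion_fps_expansion[OF _ _ hol]) auto
qed

lemma taylor_coeff_0: "taylor_coeff f 0 = f 0"
  by (simp add: fps_expansion_def)

lemma taylor_coeff_const: "taylor_coeff (\<lambda>_. c) k = (if k = 0 then c else 0)"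
  by (simp add: fps_expansion_eqI[OF has_fps_expansion_const])

lemma taylor_coeff_add:
  assumes "f \<in> dirichlet_space \<alpha>" "g \<in> dirichlet_space \<alpha>"
  shows "taylor_coeff (\<lambda>z. f z + g z) k = taylor_coeff f k + taylor_coeff g k"
  using fps_expansion_eqI[OF has_fps_expansion_add[OF assms[THEN dirichlet_spaceD(2)]]] by simp

lemma taylor_coeff_cmult:
  assumes "f \<in> dirichlet_space \<alpha>"
  shows "taylor_coeff (\<lambda>z. c * f z) k = c * taylor_coeff f k"
  using fps_expansion_eqI[OF has_fps_expansion_cmult_left[OF assms[THEN dirichlet_spaceD(2)]]]
  by simp

lemma taylor_coeff_mult_z_Suc:
  assumes "f \<in> dirichlet_space \<alpha>"
  shows "taylor_coeff (\<lambda>z. z * f z) (Suc k) = taylor_coeff f k"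
  using fps_expansion_eqI[OF has_fps_expansion_mult[OF has_fps_expansion_fps_X
        assms[THEN dirichlet_spaceD(2)]]]
  by simp

section \<open>D_\<alpha> as a vector space stable under multiplication by polynomials\<close>

lemma dirichlet_space_const: "(\<lambda>_. c) \<in> dirichlet_space \<alpha>"
proof -
  have "summable (\<lambda>k. (real k + 1) powr \<alpha> * (cmod (taylor_coeff (\<lambda>_. c) k))\<^sup>2)"
    by (rule summable_finite[of "{0}"]) (auto simp: taylor_coeff_const)
  thus ?thesis by (simp add: dirichlet_space_def)
qed

lemma dirichlet_space_cmult:
  assumes "f \<in> dirichlet_space \<alpha>"
  shows "(\<lambda>z. c * f z) \<in> dirichlet_space \<alpha>"
proof -
  have "summable (\<lambda>k. (cmod c)\<^sup>2 * ((real k + 1) powr \<alpha> * (cmod (taylor_coeff f k))\<^sup>2))"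
    by (intro summable_mult dirichlet_spaceD[OF assms])
  thus ?thesis
    unfolding dirichlet_space_def mem_Collect_eq taylor_coeff_cmult[OF assms]
    by (auto simp: norm_mult power_mult_distrib mult_ac
        intro!: holomorphic_intros dirichlet_spaceD(1)[OF assms])
qed

text \<open>The triangle inequality followed by 2|a||b| \<le> |a|^2 + |b|^2. It provides the
  summable majorant for the coefficients of a sum of two members of D_\<alpha>.\<close>

lemma cmod_add_power2_le: "(cmod (a + b))\<^sup>2 \<le> 2 * (cmod a)\<^sup>2 + 2 * (cmod b)\<^sup>2"
proof -
  have "(cmod (a + b))\<^sup>2 \<le> (cmod a + cmod b)\<^sup>2"
    by (intro power_mono norm_triangle_ineq) auto
  also have "\<dots> \<le> 2 * (cmod a)\<^sup>2 + 2 * (cmod b)\<^sup>2"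
    using sum_squares_bound[of "cmod a" "cmod b"] by (simp add: power2_sum)
  finally show ?thesis .
qed

lemma dirichlet_space_add:
  assumes "f \<in> dirichlet_space \<alpha>" "g \<in> dirichlet_space \<alpha>"
  shows "(\<lambda>z. f z + g z) \<in> dirichlet_space \<alpha>"
proof -
  have "summable (\<lambda>k. 2 * ((real k + 1) powr \<alpha> * (cmod (taylor_coeff f k))\<^sup>2)
                    + 2 * ((real k + 1) powr \<alpha> * (cmod (taylor_coeff g k))\<^sup>2))"
    by (intro summable_add summable_mult dirichlet_spaceD assms)
  hence "summable (\<lambda>k. (real k + 1) powr \<alpha> * (cmod (taylor_coeff f k + taylor_coeff g k))\<^sup>2)"
  proof (rule summable_comparison_test'[where N = 0], goal_cases)
    case (1 k)
    show ?case
      using mult_left_mono[OF cmod_add_power2_le[of "taylor_coeff f k" "taylor_coeff g k"],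
          of "(real k + 1) powr \<alpha>"]
      by (simp add: algebra_simps)
  qed
  thus ?thesis
    unfolding dirichlet_space_def mem_Collect_eq taylor_coeff_add[OF assms]
    by (auto intro!: holomorphic_intros dirichlet_spaceD(1)[OF assms(1)] dirichlet_spaceD(1)[OF assms(2)])
qed

lemma dirichlet_space_sum:
  assumes "\<And>k. k \<in> A \<Longrightarrow> g k \<in> dirichlet_space \<alpha>"
  shows "(\<lambda>z. \<Sum>k\<in>A. g k z) \<in> dirichlet_space \<alpha>"
  using assms
  by (induction A rule: infinite_finite_induct) (auto intro: dirichlet_space_add dirichlet_space_const)

text \<open>The ratio (k+2)/(k+1) lies between 1 and 2. As the base is at least 1, replacing the
  exponent \<alpha> by its absolute value can only increase the power; the exponent is then
  nonnegative, so the base may be replaced by 2. This covers both signs of \<alpha>, and makes the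
  coefficient shift bounded on D_\<alpha>.\<close>

lemma weight_Suc_le:
  "(real (Suc k) + 1) powr \<alpha> \<le> 2 powr \<bar>\<alpha>\<bar> * (real k + 1) powr \<alpha>"
proof -
  have "((real (Suc k) + 1) / (real k + 1)) powr \<alpha> \<le> ((real (Suc k) + 1) / (real k + 1)) powr \<bar>\<alpha>\<bar>"
    by (rule powr_mono) (auto simp: field_simps)
  also have "\<dots> \<le> 2 powr \<bar>\<alpha>\<bar>"
    by (rule powr_mono2) (auto simp: field_simps)
  finally show ?thesis
    by (simp add: powr_divide pos_divide_le_eq)
qed

lemma dirichlet_space_mult_z:
  assumes "f \<in> dirichlet_space \<alpha>"
  shows "(\<lambda>z. z * f z) \<in> dirichlet_space \<alpha>"
proof -
  have "summable (\<lambda>k. 2 powr \<bar>\<alpha>\<bar> * ((real k + 1) powr \<alpha> * (cmod (taylor_coeff f k))\<^sup>2))"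
    by (intro summable_mult dirichlet_spaceD assms)
  hence "summable (\<lambda>k. (real (Suc k) + 1) powr \<alpha> * (cmod (taylor_coeff (\<lambda>z. z * f z) (Suc k)))\<^sup>2)"
  proof (rule summable_comparison_test'[where N = 0], goal_cases)
    case (1 k)
    show ?case
      unfolding taylor_coeff_mult_z_Suc[OF assms]
      using mult_right_mono[OF weight_Suc_le[of k \<alpha>], of "(cmod (taylor_coeff f k))\<^sup>2"]
      by (simp add: mult_ac)
  qed
  \<comment> \<open>Only the term at index 0 was missing, and one term does not affect
    convergence.\<close>
  hence "summable (\<lambda>k. (real k + 1) powr \<alpha> * (cmod (taylor_coeff (\<lambda>z. z * f z) k))\<^sup>2)"
    by (rule summable_Suc_iff[THEN iffD1])
  thus ?thesis
    unfolding dirichlet_space_def mem_Collect_eq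
    by (auto intro!: holomorphic_intros dirichlet_spaceD(1)[OF assms])
qed

text \<open>Horner's scheme: \<open>pCons a q\<close> acts as a + z q(z), so scalar multiples, the
  shift and addition suffice. All functions q f compared in the minimization thus have convergent
  norm series.\<close>

lemma dirichlet_space_poly_mult:
  assumes "f \<in> dirichlet_space \<alpha>"
  shows "(\<lambda>z. poly q z * f z) \<in> dirichlet_space \<alpha>"
proof (induction q)
  case 0
  show ?case by (simp add: dirichlet_space_const)
next
  case (pCons a q)
  show ?case
    using dirichlet_space_add[OF dirichlet_space_cmult[OF assms, of a]
        dirichlet_space_mult_z[OF pCons.IH]]
    by (simp add: algebra_simps)
qed

section \<open>Sesquilinearity of the inner product\<close>

lemma dirichlet_inner_summable:
  assumes "f \<in> dirichlet_space \<alpha>" "g \<in> dirichlet_space \<alpha>"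
  shows "summable (\<lambda>k. of_real ((real k + 1) powr \<alpha>) * taylor_coeff f k * cnj (taylor_coeff g k))"
proof -
  have "summable (\<lambda>k. (real k + 1) powr \<alpha> * (cmod (taylor_coeff f k))\<^sup>2
                    + (real k + 1) powr \<alpha> * (cmod (taylor_coeff g k))\<^sup>2)"
    by (intro summable_add dirichlet_spaceD assms)
  thus ?thesis
  proof (rule summable_comparison_test'[where N = 0], goal_cases)
    case (1 k)
    \<comment> \<open>The inequality 2xy \<le> x^2 + y^2 dominates each cross term by terms of the
      two norm series. Absolute convergence follows, and this is what justifies the termwise
      manipulation of \<open>suminf\<close> later on.\<close>
    have "2 * (cmod (taylor_coeff f k) * cmod (taylor_coeff g k))
        \<le> (cmod (taylor_coeff f k))\<^sup>2 + (cmod (taylor_coeff g k))\<^sup>2"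
      using sum_squares_bound[of "cmod (taylor_coeff f k)" "cmod (taylor_coeff g k)"] by simp
    moreover have "0 \<le> cmod (taylor_coeff f k) * cmod (taylor_coeff g k)"
      by simp
    ultimately have "cmod (taylor_coeff f k) * cmod (taylor_coeff g k)
        \<le> (cmod (taylor_coeff f k))\<^sup>2 + (cmod (taylor_coeff g k))\<^sup>2"
      by linarith
    from mult_left_mono[OF this, of "(real k + 1) powr \<alpha>"] show ?case
      by (simp add: norm_mult algebra_simps)
  qed
qed

lemma dirichlet_inner_add_left:
  assumes "f \<in> dirichlet_space \<alpha>" "g \<in> dirichlet_space \<alpha>" "h \<in> dirichlet_space \<alpha>"
  shows "dirichlet_inner \<alpha> (\<lambda>z. f z + g z) h = dirichlet_inner \<alpha> f h + dirichlet_inner \<alpha> g h"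
  unfolding dirichlet_inner_def taylor_coeff_add[OF assms(1,2)]
  using suminf_add[OF dirichlet_inner_summable[OF assms(1,3)] dirichlet_inner_summable[OF assms(2,3)]]
  by (simp add: algebra_simps)

lemma dirichlet_inner_cmult_left:
  assumes "f \<in> dirichlet_space \<alpha>" "h \<in> dirichlet_space \<alpha>"
  shows "dirichlet_inner \<alpha> (\<lambda>z. c * f z) h = c * dirichlet_inner \<alpha> f h"
  unfolding dirichlet_inner_def taylor_coeff_cmult[OF assms(1)]
  using suminf_mult[OF dirichlet_inner_summable[OF assms], of c]
  by (simp add: mult_ac)

lemma dirichlet_inner_commute:
  assumes "f \<in> dirichlet_space \<alpha>" "g \<in> dirichlet_space \<alpha>"
  shows "dirichlet_inner \<alpha> g f = cnj (dirichlet_inner \<alpha> f g)"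
proof -
  have "(\<lambda>k. of_real ((real k + 1) powr \<alpha>) * taylor_coeff f k * cnj (taylor_coeff g k))
          sums dirichlet_inner \<alpha> f g"
    unfolding dirichlet_inner_def by (intro summable_sums dirichlet_inner_summable assms)
  hence "(\<lambda>k. cnj (of_real ((real k + 1) powr \<alpha>) * taylor_coeff f k * cnj (taylor_coeff g k)))
          sums cnj (dirichlet_inner \<alpha> f g)"
    by (subst sums_cnj)
  thus ?thesis
    unfolding dirichlet_inner_def[of \<alpha> g f] by (simp add: sums_iff mult_ac)
qed

lemma dirichlet_inner_add_right:
  assumes "f \<in> dirichlet_space \<alpha>" "g \<in> dirichlet_space \<alpha>" "h \<in> dirichlet_space \<alpha>"
  shows "dirichlet_inner \<alpha> h (\<lambda>z. f z + g z) = dirichlet_inner \<alpha> h f + dirichlet_inner \<alpha> h g"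
proof -
  have "dirichlet_inner \<alpha> h (\<lambda>z. f z + g z) = cnj (dirichlet_inner \<alpha> (\<lambda>z. f z + g z) h)"
    by (intro dirichlet_inner_commute dirichlet_space_add assms)
  thus ?thesis
    by (simp add: dirichlet_inner_add_left[OF assms] dirichlet_inner_commute[OF assms(1,3)]
        dirichlet_inner_commute[OF assms(2,3)])
qed

text \<open>Only the term k = 0 survives, and its weight is 1 for every \<alpha>. This is the
  evaluation at 0 that brings f(0) into the formula.\<close>

lemma dirichlet_inner_const_right:
  "dirichlet_inner \<alpha> g (\<lambda>_. c) = g 0 * cnj c"
proof -
  have "dirichlet_inner \<alpha> g (\<lambda>_. c) =
      (\<Sum>k\<in>{0}. of_real ((real k + 1) powr \<alpha>) * taylor_coeff g k * cnj (taylor_coeff (\<lambda>_. c) k))"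
    unfolding dirichlet_inner_def by (rule suminf_finite) (auto simp: taylor_coeff_const)
  thus ?thesis by (simp add: taylor_coeff_const taylor_coeff_0)
qed

lemma dirichlet_inner_sum_left:
  assumes "finite A" "\<And>k. k \<in> A \<Longrightarrow> g k \<in> dirichlet_space \<alpha>" "h \<in> dirichlet_space \<alpha>"
  shows "dirichlet_inner \<alpha> (\<lambda>z. \<Sum>k\<in>A. c k * g k z) h = (\<Sum>k\<in>A. c k * dirichlet_inner \<alpha> (g k) h)"
  using assms
proof (induction A rule: finite_induct)
  case empty
  show ?case by (simp add: dirichlet_inner_def taylor_coeff_const)
next
  case (insert k A)
  thus ?case
    by (simp add: dirichlet_inner_add_left dirichlet_inner_cmult_left dirichlet_space_cmult
        dirichlet_space_sum)
qed

lemma dirichlet_inner_sum_right: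
  assumes "finite A" "\<And>k. k \<in> A \<Longrightarrow> g k \<in> dirichlet_space \<alpha>" "h \<in> dirichlet_space \<alpha>"
  shows "dirichlet_inner \<alpha> h (\<lambda>z. \<Sum>k\<in>A. c k * g k z)
       = (\<Sum>k\<in>A. cnj (c k) * dirichlet_inner \<alpha> h (g k))"
proof -
  have "(\<lambda>z. \<Sum>k\<in>A. c k * g k z) \<in> dirichlet_space \<alpha>"
    by (intro dirichlet_space_sum dirichlet_space_cmult assms)
  hence "dirichlet_inner \<alpha> h (\<lambda>z. \<Sum>k\<in>A. c k * g k z)
       = cnj (dirichlet_inner \<alpha> (\<lambda>z. \<Sum>k\<in>A. c k * g k z) h)"
    by (intro dirichlet_inner_commute assms)
  also have "\<dots> = (\<Sum>k\<in>A. cnj (c k) * cnj (dirichlet_inner \<alpha> (g k) h))"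
    using assms by (simp add: dirichlet_inner_sum_left)
  also have "\<dots> = (\<Sum>k\<in>A. cnj (c k) * dirichlet_inner \<alpha> h (g k))"
    by (intro sum.cong refl arg_cong2[where f = "(*)"] dirichlet_inner_commute[symmetric] assms)
  finally show ?thesis .
qed

section \<open>The norm and the Pythagorean identity\<close>

lemma dirichlet_norm_power2:
  assumes "f \<in> dirichlet_space \<alpha>"
  shows "(dirichlet_norm \<alpha> f)\<^sup>2 = Re (dirichlet_inner \<alpha> f f)"
proof -
  let ?t = "\<lambda>k. (real k + 1) powr \<alpha> * (cmod (taylor_coeff f k))\<^sup>2"
  have "(dirichlet_norm \<alpha> f)\<^sup>2 = (\<Sum>k. ?t k)"
    unfolding dirichlet_norm_def
    by (intro real_sqrt_pow2 suminf_nonneg dirichlet_spaceD assms) auto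
  moreover have "dirichlet_inner \<alpha> f f = (\<Sum>k. complex_of_real (?t k))"
    unfolding dirichlet_inner_def
    by (intro suminf_cong) (simp only: mult.assoc complex_norm_square[symmetric] of_real_mult)
  ultimately show ?thesis
    by (simp only: suminf_of_real[OF dirichlet_spaceD(3)[OF assms], symmetric] Re_complex_of_real)
qed

lemma dirichlet_norm_power2_add_orthogonal:
  assumes "f \<in> dirichlet_space \<alpha>" "g \<in> dirichlet_space \<alpha>" "dirichlet_inner \<alpha> g f = 0"
  shows "(dirichlet_norm \<alpha> (\<lambda>z. f z + g z))\<^sup>2 = (dirichlet_norm \<alpha> f)\<^sup>2 + (dirichlet_norm \<alpha> g)\<^sup>2"
proof -
  \<comment> \<open>Both cross terms have to vanish; the second is the conjugate of the
    first.\<close>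
  have "dirichlet_inner \<alpha> f g = 0"
    using dirichlet_inner_commute[OF assms(2,1)] assms(3) by simp
  thus ?thesis
    using assms
    by (simp add: dirichlet_norm_power2 dirichlet_inner_add_left dirichlet_inner_add_right
        dirichlet_space_add)
qed

section \<open>Expansion in the orthogonal polynomials\<close>

lemma poly_in_span_of_degrees:
  fixes \<phi> :: "nat \<Rightarrow> 'a::field poly"
  assumes "\<And>k. degree (\<phi> k) = k" "\<And>k. \<phi> k \<noteq> 0" "degree q \<le> n"
  shows "\<exists>d. q = (\<Sum>k\<le>n. smult (d k) (\<phi> k))"
  using assms(3)
proof (induction n arbitrary: q)
  case 0
  obtain a b where "q = [:a:]" "\<phi> 0 = [:b:]"
    using 0 assms(1)[of 0] by (metis degree_eq_zeroE le_zero_eq)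
  moreover have "b \<noteq> 0"
    using assms(2)[of 0] \<open>\<phi> 0 = [:b:]\<close> by auto
  ultimately show ?case
    by (intro exI[of _ "\<lambda>_. a / b"]) simp
next
  case (Suc n)
  \<comment> \<open>This multiple of \<open>\<phi> (Suc n)\<close> cancels the coefficient of
    \<open>q\<close> at \<open>Suc n\<close>, so the difference has degree at most \<open>n\<close>
    and falls under the induction hypothesis.\<close>
  define c where "c = coeff q (Suc n) / lead_coeff (\<phi> (Suc n))"
  have lc: "coeff (\<phi> (Suc n)) (Suc n) \<noteq> 0"
    using assms(1,2)[of "Suc n"] by (metis leading_coeff_0_iff)
  have "degree (q - smult c (\<phi> (Suc n))) \<le> Suc n"
    using Suc.prems assms(1) by (intro degree_diff_le) (auto intro: order.trans[OF degree_smult_le])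
  moreover have "coeff (q - smult c (\<phi> (Suc n))) (Suc n) = 0"
    using lc by (simp add: c_def assms(1))
  ultimately have "degree (q - smult c (\<phi> (Suc n))) \<le> n"
    by (metis le_SucE leading_coeff_0_iff degree_0 le0)
  from Suc.IH[OF this] obtain d where
    "q - smult c (\<phi> (Suc n)) = (\<Sum>k\<le>n. smult (d k) (\<phi> k))" by blast
  hence "q = (\<Sum>k\<le>Suc n. smult ((d(Suc n := c)) k) (\<phi> k))"
    by (simp add: algebra_simps)
  thus ?case by blast
qed

text \<open>A finite Parseval identity: sesquilinearity gives a double sum, of which orthonormality
  leaves the diagonal. It serves once to pair with the candidate and once, with
  \<open>e = d\<close>, to compute a norm.\<close>

lemma dirichlet_inner_orthogonal_sums:
  assumes f: "f \<in> dirichlet_space \<alpha>" and orth: "orthogonal_polynomials \<alpha> f \<phi>" and A: "finite A"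
  shows "dirichlet_inner \<alpha> (\<lambda>z. poly (\<Sum>k\<in>A. smult (d k) (\<phi> k)) z * f z)
           (\<lambda>z. poly (\<Sum>k\<in>A. smult (e k) (\<phi> k)) z * f z) = (\<Sum>k\<in>A. d k * cnj (e k))"
proof -
  have expand: "(\<lambda>z. poly (\<Sum>k\<in>A. smult (c k) (\<phi> k)) z * f z)
      = (\<lambda>z. \<Sum>k\<in>A. c k * (poly (\<phi> k) z * f z))" for c
    by (simp add: fun_eq_iff poly_sum sum_distrib_right mult.assoc)
  have mem: "(\<lambda>z. poly (\<phi> k) z * f z) \<in> dirichlet_space \<alpha>" for k
    by (rule dirichlet_space_poly_mult[OF f])
  have delta: "dirichlet_inner \<alpha> (\<lambda>z. poly (\<phi> k) z * f z) (\<lambda>z. poly (\<phi> j) z * f z)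
      = (if k = j then 1 else 0)" for k j
    using orth by (simp add: orthogonal_polynomials_def weighted_inner_def)
  have "dirichlet_inner \<alpha> (\<lambda>z. \<Sum>k\<in>A. d k * (poly (\<phi> k) z * f z))
          (\<lambda>z. \<Sum>k\<in>A. e k * (poly (\<phi> k) z * f z))
      = (\<Sum>k\<in>A. d k * (\<Sum>j\<in>A. cnj (e j) * (if k = j then 1 else 0)))"
    by (simp add: dirichlet_inner_sum_left dirichlet_inner_sum_right mem delta A
        dirichlet_space_sum dirichlet_space_cmult del: sum.delta sum.delta')
  also have "\<dots> = (\<Sum>k\<in>A. d k * cnj (e k))"
    using A by (simp add: if_distrib sum.delta cong: if_cong)
  finally show ?thesis
    by (simp only: expand)
qed

section \<open>Identification of the minimizer\<close>

lemma optimal_approximant_eq: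
  assumes f: "f \<in> dirichlet_space \<alpha>" and orth: "orthogonal_polynomials \<alpha> f \<phi>"
    and opt: "optimal_approximant \<alpha> f n p"
  shows "p = (\<Sum>k\<le>n. smult (cnj (f 0 * poly (\<phi> k) 0)) (\<phi> k))"
proof -
  define P where "P = (\<Sum>k\<le>n. smult (cnj (f 0 * poly (\<phi> k) 0)) (\<phi> k))"
  have deg: "degree (\<phi> k) = k" and nz: "\<phi> k \<noteq> 0" for k
    using orth by (auto simp: orthogonal_polynomials_def dest: spec[of _ k])
  have degP: "degree P \<le> n"
    unfolding P_def by (intro degree_sum_le) (auto intro: order.trans[OF degree_smult_le] simp: deg)
  have "degree (p - P) \<le> n"
    using opt degP by (auto simp: optimal_approximant_def intro: degree_diff_le)
  then obtain d where d: "p - P = (\<Sum>k\<le>n. smult (d k) (\<phi> k))"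
    using poly_in_span_of_degrees[OF deg nz] by blast

  let ?r = "\<lambda>z. poly (p - P) z * f z" and ?e = "\<lambda>z. poly P z * f z - 1"
  have r: "?r \<in> dirichlet_space \<alpha>" and Pf: "(\<lambda>z. poly P z * f z) \<in> dirichlet_space \<alpha>"
    by (rule dirichlet_space_poly_mult[OF f])+
  have e_eq: "?e = (\<lambda>z. poly P z * f z + (- 1))"
    by simp
  have e: "?e \<in> dirichlet_space \<alpha>"
    unfolding e_eq by (intro dirichlet_space_add Pf dirichlet_space_const)

  \<comment> \<open>The second slot conjugates the coefficients of \<open>P\<close> back to f(0)
    \<phi>_k(0), so Parseval yields f(0) times the sum of d_k \<phi>_k(0), which is the value of
    \<open>?r\<close> at 0. Pairing \<open>?r\<close> with the constant -1 then contributes exactly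
    the negative of this.\<close>
  have "dirichlet_inner \<alpha> ?r (\<lambda>z. poly P z * f z) = f 0 * poly (p - P) 0"
    unfolding d unfolding P_def dirichlet_inner_orthogonal_sums[OF f orth finite_atMost]
    by (simp add: poly_sum sum_distrib_left mult_ac)
  hence "dirichlet_inner \<alpha> ?r ?e = 0"
    unfolding e_eq
    by (subst dirichlet_inner_add_right[OF Pf dirichlet_space_const r])
       (simp add: dirichlet_inner_const_right mult_ac del: poly_diff)
  hence "(dirichlet_norm \<alpha> (\<lambda>z. ?e z + ?r z))\<^sup>2 = (dirichlet_norm \<alpha> ?e)\<^sup>2 + (dirichlet_norm \<alpha> ?r)\<^sup>2"
    by (rule dirichlet_norm_power2_add_orthogonal[OF e r])
  moreover have "(\<lambda>z. ?e z + ?r z) = (\<lambda>z. poly p z * f z - 1)"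
    by (simp add: fun_eq_iff algebra_simps)
  \<comment> \<open>\<open>P\<close> has degree at most \<open>n\<close>, so it competes with
    \<open>p\<close>. Squaring the inequality requires a nonnegative norm; the summability behind
    that comes from writing p f - 1 as \<open>?e\<close> plus \<open>?r\<close>.\<close>
  moreover have "(dirichlet_norm \<alpha> (\<lambda>z. poly p z * f z - 1))\<^sup>2 \<le> (dirichlet_norm \<alpha> ?e)\<^sup>2"
  proof (rule power_mono)
    show "0 \<le> dirichlet_norm \<alpha> (\<lambda>z. poly p z * f z - 1)"
      unfolding dirichlet_norm_def
      by (intro real_sqrt_ge_zero suminf_nonneg dirichlet_spaceD)
         (use \<open>(\<lambda>z. ?e z + ?r z) = _\<close> dirichlet_space_add[OF e r] in auto)
  qed (use opt degP in \<open>auto simp: optimal_approximant_def\<close>)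
  ultimately have "(dirichlet_norm \<alpha> ?r)\<^sup>2 \<le> 0"
    by simp
  moreover have "(dirichlet_norm \<alpha> ?r)\<^sup>2 = (\<Sum>k\<le>n. (cmod (d k))\<^sup>2)"
    unfolding dirichlet_norm_power2[OF r]
    unfolding d dirichlet_inner_orthogonal_sums[OF f orth finite_atMost]
    by (simp add: complex_norm_square[symmetric] del: of_real_power)
  \<comment> \<open>The squared norm of \<open>?r\<close> is at most 0 and equals a sum of squares,
    so every \<open>d k\<close> vanishes and p = P.\<close>
  ultimately have "(\<Sum>k\<le>n. (cmod (d k))\<^sup>2) = 0"
    by (simp add: antisym sum_nonneg)
  hence "p - P = 0"
    unfolding d by (subst (asm) sum_nonneg_eq_0_iff) auto
  thus ?thesis by (simp add: P_def)
qed

theorem proposition3p1: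
  fixes \<alpha> :: real and f :: "complex \<Rightarrow> complex"
    and \<phi> p :: "nat \<Rightarrow> complex poly"
  assumes "f \<in> dirichlet_space \<alpha>" and "f 0 \<noteq> 0"
    and "orthogonal_polynomials \<alpha> f \<phi>"
    and "\<And>n. optimal_approximant \<alpha> f n (p n)"
  shows "\<forall>n z. poly (p n) z = cnj (f 0) * (\<Sum>k=0..n. cnj (poly (\<phi> k) 0) * poly (\<phi> k) z)"
  by (simp add: optimal_approximant_eq[OF assms(1,3,4)] poly_sum sum_distrib_left mult.assoc
      atLeast0AtMost)

end
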